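(* Let $Y$ be a locally compact $\sigma$-compact Hausdorff space and $q:Y\to X$ a quotient map with $X$ Hausdorff. Let $\operatorname{Cl}(Y)$ be the hyperspace of closed subsets of $Y$ with the Fell topology, and let $Y_*$ be the closure of the set $D=\{q^{-1}(x): x\in X\}$ in $\operatorname{Cl}(Y)\setminus\{\emptyset\}$. Let $q_*:Y_*\to X$ be the map given by $q_*(F)=q(y)$ for any $y\in F$. Then $Y_*$ is a locally compact, $\sigma$-compact Hausdorff space, and $q_*:Y_*\to X$ is a pure quotient map inducing the same topology on $X$ as $q$ (i.e. for $C\subseteq X$, $q_*^{-1}(C)$ is closed in $Y_*$ if and only if $q^{-1}(C)$ is closed in $Y$).
   Context: Fell topology: for a topological space $Y$, $\operatorname{Cl}(Y)$ is the set of all closed subsets of $Y$ (including $\emptyset$), with base of open sets $U(K,\Phi)=\{S\in\operatorname{Cl}(Y): S\cap K=\emptyset,\ S\cap O\neq\emptyset \text{ for all } O\in\Phi\}$, where $K$ ranges over compact subsets of $Y$ and $\Phi$ over finite families of open subsets of $Y$. The map $q_*$ is well defined because every $F\in Y_*$ is nonempty and contained in a single fibre $q^{-1}(x)$ of $q$. Convergence to infinity: a net in a locally compact space converges to $\infty$ if it is eventually outside every compact set. Pure quotient map: let $Z$ be a locally compact $\sigma$-compact Hausdorff space and $p:Z\to X$ a quotient map with $X$ Hausdorff. Then $p$ is pure if there is a subset $D\subseteq Z$ such that (i) $D$ is dense in $Z$ and $p|_D$ is injective, and (ii) for every net $(d_\alpha)$ in $D$ with $d_\alpha\to\infty$, every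 net $(e_\alpha)$ in $Z$ (with the same index set) satisfying $p(e_\alpha)=p(d_\alpha)$ for all $\alpha$ also satisfies $e_\alpha\to\infty$. *)

theory Defs
  imports "HOL-Analysis.Analysis"
begin

definition sigma_compact_space :: "'a topology \<Rightarrow> bool" where
  "sigma_compact_space Y \<longleftrightarrow>
     (\<exists>\<K>. countable \<K> \<and> (\<forall>K\<in>\<K>. compactin Y K) \<and> \<Union>\<K> = topspace Y)"

subsection \<open>The Fell topology\<close>

definition fell_basic :: "'a topology \<Rightarrow> 'a set \<Rightarrow> 'a set set \<Rightarrow> 'a set set" where
  "fell_basic Y K \<Phi> = {S. closedin Y S \<and> S \<inter> K = {} \<and> (\<forall>G\<in>\<Phi>. S \<inter> G \<noteq> {})}"

definition fell_topology :: "'a topology \<Rightarrow> 'a set topology" where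
  "fell_topology Y =
     topology (arbitrary union_of
       (\<lambda>U. \<exists>K \<Phi>. compactin Y K \<and> finite \<Phi> \<and> (\<forall>G\<in>\<Phi>. openin Y G) \<and> U = fell_basic Y K \<Phi>))"

lemma openin_fell_topology:
  "openin (fell_topology Y) =
     arbitrary union_of
       (\<lambda>U. \<exists>K \<Phi>. compactin Y K \<and> finite \<Phi> \<and> (\<forall>G\<in>\<Phi>. openin Y G) \<and> U = fell_basic Y K \<Phi>)"
proof -
  have "istopology (arbitrary union_of
       (\<lambda>U. \<exists>K \<Phi>. compactin Y K \<and> finite \<Phi> \<and> (\<forall>G\<in>\<Phi>. openin Y G) \<and> U = fell_basic Y K \<Phi>))"
  proof (rule istopology_base, elim exE conjE)
    fix S T K \<Phi> K' \<Phi>'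
    assume *: "compactin Y K" "finite \<Phi>" "\<forall>G\<in>\<Phi>. openin Y G" "S = fell_basic Y K \<Phi>"
      "compactin Y K'" "finite \<Phi>'" "\<forall>G\<in>\<Phi>'. openin Y G" "T = fell_basic Y K' \<Phi>'"
    have "S \<inter> T = fell_basic Y (K \<union> K') (\<Phi> \<union> \<Phi>')"
      unfolding * fell_basic_def by blast
    with * show "\<exists>K \<Phi>. compactin Y K \<and> finite \<Phi> \<and> (\<forall>G\<in>\<Phi>. openin Y G) \<and> S \<inter> T = fell_basic Y K \<Phi>"
      by (intro exI[of _ "K \<union> K'"] exI[of _ "\<Phi> \<union> \<Phi>'"]) (auto intro: compactin_Un)
  qed
  then show ?thesis
    by (simp add: fell_topology_def)
qed

lemma openin_fell_basic:
  assumes "compactin Y K" "finite \<Phi>" "\<And>G. G \<in> \<Phi> \<Longrightarrow> openin Y G"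
  shows "openin (fell_topology Y) (fell_basic Y K \<Phi>)"
  unfolding openin_fell_topology by (rule union_of_inc) (use assms in \<open>auto simp: arbitrary_def\<close>)

lemma topspace_fell_topology: "topspace (fell_topology Y) = {S. closedin Y S}"
proof
  show "topspace (fell_topology Y) \<subseteq> {S. closedin Y S}"
    using openin_topspace[of "fell_topology Y"]
    unfolding openin_fell_topology union_of_def fell_basic_def by blast
  have "openin (fell_topology Y) (fell_basic Y {} {})"
    by (rule openin_fell_basic) auto
  then show "{S. closedin Y S} \<subseteq> topspace (fell_topology Y)"
    using openin_subset by (fastforce simp: fell_basic_def)
qed

subsection \<open>Nets and pure quotient maps\<close>

definition directed_set :: "'i set \<Rightarrow> ('i \<times> 'i) set \<Rightarrow> bool" where
  "directed_set I r \<longleftrightarrow> I \<noteq> {} \<and> preorder_on I r \<and>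
     (\<forall>i\<in>I. \<forall>j\<in>I. \<exists>k\<in>I. (i, k) \<in> r \<and> (j, k) \<in> r)"

definition net_to_infinity ::
  "'a topology \<Rightarrow> 'i set \<Rightarrow> ('i \<times> 'i) set \<Rightarrow> ('i \<Rightarrow> 'a) \<Rightarrow> bool" where
  "net_to_infinity Z I r d \<longleftrightarrow>
     (\<forall>K. compactin Z K \<longrightarrow> (\<exists>i\<in>I. \<forall>j. (i, j) \<in> r \<longrightarrow> d j \<notin> K))"

text \<open>
  A definition cannot quantify over all types of net indices, so the index sets below are the
  directed sets of elements of type \<^typ>\<open>'a set\<close>. This is no restriction: by
  \<open>pure_witness_net\<close>, the condition then holds for nets with indices of any type.
\<close>

definition pure_witness :: "'a topology \<Rightarrow> ('a \<Rightarrow> 'b) \<Rightarrow> 'a set \<Rightarrow> bool" where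
  "pure_witness Z p D \<longleftrightarrow>
     D \<subseteq> topspace Z \<and> Z closure_of D = topspace Z \<and> inj_on p D \<and>
     (\<forall>(I :: 'a set set) r d e.
        directed_set I r \<and> d \<in> I \<rightarrow> D \<and> net_to_infinity Z I r d \<and>
        e \<in> I \<rightarrow> topspace Z \<and> (\<forall>i\<in>I. p (e i) = p (d i)) \<longrightarrow>
        net_to_infinity Z I r e)"

definition pure_quotient_map :: "'a topology \<Rightarrow> 'b topology \<Rightarrow> ('a \<Rightarrow> 'b) \<Rightarrow> bool" where
  "pure_quotient_map Z X p \<longleftrightarrow>
     locally_compact_space Z \<and> sigma_compact_space Z \<and> Hausdorff_space Z \<and>
     Hausdorff_space X \<and> quotient_map Z X p \<and> (\<exists>D. pure_witness Z p D)"

lemma pure_witness_net: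
  fixes Z :: "'a topology" and I :: "'i set"
  assumes pure: "pure_witness Z p D"
    and dir: "directed_set I r"
    and d: "d \<in> I \<rightarrow> D" "net_to_infinity Z I r d"
    and e: "e \<in> I \<rightarrow> topspace Z" "\<And>i. i \<in> I \<Longrightarrow> p (e i) = p (d i)"
  shows "net_to_infinity Z I r e"
proof (rule ccontr)
  assume "\<not> net_to_infinity Z I r e"
  then obtain K where K: "compactin Z K" and freq: "\<And>i. i \<in> I \<Longrightarrow> \<exists>j. (i, j) \<in> r \<and> e j \<in> K"
    unfolding net_to_infinity_def by blast
  have r: "r \<subseteq> I \<times> I"
    using dir by (simp add: directed_set_def preorder_on_def)
  have "\<exists>j\<in>I. d j \<notin> L \<and> e j \<in> K" if "compactin Z L" for L
    using d(2) that freq r unfolding net_to_infinity_def by (meson SigmaE2 subsetD)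
  then obtain g where g: "\<And>L. compactin Z L \<Longrightarrow> g L \<in> I \<and> d (g L) \<notin> L \<and> e (g L) \<in> K"
    by metis
  define J where "J = {L. compactin Z L}"
  define s where "s = {(L, M). compactin Z L \<and> compactin Z M \<and> L \<subseteq> M}"
  have "directed_set J s"
    unfolding directed_set_def
  proof (intro conjI ballI)
    show "J \<noteq> {}"
      unfolding J_def using compactin_empty by blast
    show "preorder_on J s"
      by (auto simp: preorder_on_def J_def s_def refl_on_def trans_def)
    fix L M assume "L \<in> J" "M \<in> J"
    then show "\<exists>N\<in>J. (L, N) \<in> s \<and> (M, N) \<in> s"
      by (intro bexI[of _ "L \<union> M"]) (auto simp: J_def s_def compactin_Un)
  qed
  moreover have "d \<circ> g \<in> J \<rightarrow> D" "e \<circ> g \<in> J \<rightarrow> topspace Z" "\<forall>L\<in>J. p ((e \<circ> g) L) = p ((d \<circ> g) L)"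
    using d e g by (auto simp: J_def)
  moreover have "net_to_infinity Z J s (d \<circ> g)"
    using g unfolding net_to_infinity_def J_def s_def by fastforce
  ultimately have "net_to_infinity Z J s (e \<circ> g)"
    using pure unfolding pure_witness_def by blast
  then obtain L where "L \<in> J" "\<And>M. (L, M) \<in> s \<Longrightarrow> e (g M) \<notin> K"
    using K unfolding net_to_infinity_def by auto
  then show False
    using g by (auto simp: J_def s_def)
qed

subsection \<open>The space of limits of fibres\<close>

definition fibres :: "'a topology \<Rightarrow> 'b topology \<Rightarrow> ('a \<Rightarrow> 'b) \<Rightarrow> 'a set set" where
  "fibres Y X q = {{y \<in> topspace Y. q y = x} |x. x \<in> topspace X}"

definition star_space :: "'a topology \<Rightarrow> 'b topology \<Rightarrow> ('a \<Rightarrow> 'b) \<Rightarrow> 'a set set" where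
  "star_space Y X q =
     subtopology (fell_topology Y) (topspace (fell_topology Y) - {{}}) closure_of fibres Y X q"

definition star_topology :: "'a topology \<Rightarrow> 'b topology \<Rightarrow> ('a \<Rightarrow> 'b) \<Rightarrow> 'a set topology" where
  "star_topology Y X q = subtopology (fell_topology Y) (star_space Y X q)"

text \<open>The choice of the point is immaterial on \<^term>\<open>star_space Y X q\<close>, see \<open>star_map_eq\<close>.\<close>

definition star_map :: "('a \<Rightarrow> 'b) \<Rightarrow> 'a set \<Rightarrow> 'b" where
  "star_map q F = q (SOME y. y \<in> F)"

lemma star_map_eq:
  assumes q: "quotient_map Y X q" and X: "Hausdorff_space X"
    and F: "F \<in> star_space Y X q" and y: "y \<in> F"
  shows "star_map q F = q y"
proof -
  have cont: "continuous_map Y X q"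
    using q by (rule quotient_imp_continuous_map)
  have cl: "closedin Y F"
    using F closure_of_subset_topspace[of "subtopology (fell_topology Y) (topspace (fell_topology Y) - {{}})"]
    by (auto simp: star_space_def topspace_fell_topology)
  have "q a = q b" if ab: "a \<in> F" "b \<in> F" for a b
  proof (rule ccontr)
    assume ne: "q a \<noteq> q b"
    have "a \<in> topspace Y" "b \<in> topspace Y"
      using cl ab closedin_subset by blast+
    moreover from this have "q a \<in> topspace X" "q b \<in> topspace X"
      using cont by (auto simp: continuous_map_def)
    ultimately obtain U V where UV: "openin X U" "openin X V" "q a \<in> U" "q b \<in> V" "disjnt U V"
      using X ne unfolding Hausdorff_space_def by meson
    define A where "A = {z \<in> topspace Y. q z \<in> U}"
    define B where "B = {z \<in> topspace Y. q z \<in> V}"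
    have "openin Y A" "openin Y B"
      unfolding A_def B_def using cont UV by (auto intro: openin_continuous_map_preimage)
    then have W: "openin (fell_topology Y) (fell_basic Y {} {A, B})"
      by (intro openin_fell_basic) auto
    have FW: "F \<in> fell_basic Y {} {A, B}"
      using cl ab UV \<open>a \<in> topspace Y\<close> \<open>b \<in> topspace Y\<close>
      by (auto simp: fell_basic_def A_def B_def)
    have "F \<in> fell_topology Y closure_of fibres Y X q"
      using F closure_of_subtopology_subset[of "fell_topology Y" _ "fibres Y X q"]
      unfolding star_space_def by blast
    then obtain G where "G \<in> fibres Y X q" "G \<in> fell_basic Y {} {A, B}"
      using W FW unfolding in_closure_of by blast
    then show False
      using UV(5) by (auto simp: fibres_def fell_basic_def A_def B_def disjnt_iff)
  qed
  then show ?thesis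
    unfolding star_map_def using y by (metis someI)
qed

end

theory Submission
  imports Defs
begin

text \<open>
  The Fell topology is always compact, and it is Hausdorff because \<open>Y\<close> is locally compact and
  Hausdorff. So the closure of the fibres in the nonempty closed sets is an open subset of a compact
  Hausdorff space. A family of nonempty closed sets is relatively compact there exactly when some
  compact subset of \<open>Y\<close> meets all of its members. This gives \<open>\<sigma>\<close>-compactness, and also purity: each
  member of the closure lies inside a fibre, so if a compact set misses the fibre it misses the member.
  The quotient topologies agree because the union of a Fell-closed family of sets is closed in \<open>Y\<close>.
\<close>

section \<open>The hyperspace of closed sets\<close>

text \<open>This is the form of the topology on which Alexander's subbase theorem operates. A basic
  set \<open>fell_basic Y K \<Phi>\<close> is the set missing \<open>K\<close> intersected with one
  hitting set for each member of \<open>\<Phi>\<close>, so induction on \<open>\<Phi>\<close> can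
  split off one open set at a time.\<close>

lemma fell_topology_subbase:
  defines "\<B> Y \<equiv> {fell_basic Y K {} |K. compactin Y K} \<union> {fell_basic Y {} {G} |G. openin Y G}"
  shows "topology (arbitrary union_of
           (finite intersection_of (\<lambda>x. x \<in> \<B> Y) relative_to topspace (fell_topology Y))) =
         fell_topology Y"
    (is "?T = _")
proof -
  have ope: "openin ?T = arbitrary union_of
           (finite intersection_of (\<lambda>x. x \<in> \<B> Y) relative_to topspace (fell_topology Y))"
    by (simp add: istopology_subbase)
  have sub: "openin (fell_topology Y) B" if "B \<in> \<B> Y" for B
    using that unfolding \<B>_def by (auto intro: openin_fell_basic)
  have base: "openin ?T B" if "B \<in> \<B> Y" for B
  proof -
    \<comment> \<open>The subbase is taken relative to the whole space, which does not change a set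
      already contained in it.\<close>
    have "B = topspace (fell_topology Y) \<inter> B"
      using openin_subset[OF sub[OF that]] by blast
    then show ?thesis
      unfolding ope using that
      by (metis (no_types, lifting) arbitrary_union_of_inc finite_intersection_of_inc relative_to_inc)
  qed
  have "openin ?T (fell_basic Y K \<Phi>)"
    if "compactin Y K" "finite \<Phi>" "\<forall>G\<in>\<Phi>. openin Y G" for K \<Phi>
    using that(2,3)
  proof (induction \<Phi>)
    case empty
    show ?case by (rule base) (use that(1) in \<open>auto simp: \<B>_def\<close>)
  next
    case (insert G \<Phi>)
    have "fell_basic Y K (insert G \<Phi>) = fell_basic Y {} {G} \<inter> fell_basic Y K \<Phi>"
      by (auto simp: fell_basic_def)
    moreover have "openin ?T (fell_basic Y {} {G})"
      by (rule base) (use insert in \<open>auto simp: \<B>_def\<close>)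
    ultimately show ?case
      using insert by auto
  qed
  then have *: "openin ?T (fell_basic Y K \<Phi>)"
    if "compactin Y K \<and> finite \<Phi> \<and> (\<forall>G\<in>\<Phi>. openin Y G)" for K \<Phi>
    using that by blast
  have "openin ?T U" if "openin (fell_topology Y) U" for U
  proof -
    let ?P = "\<lambda>B. \<exists>K \<Phi>. compactin Y K \<and> finite \<Phi> \<and> (\<forall>G\<in>\<Phi>. openin Y G) \<and> B = fell_basic Y K \<Phi>"
    have "(arbitrary union_of ?P) U"
      using that by (simp only: openin_fell_topology)
    then obtain \<U> where \<U>: "\<U> \<subseteq> Collect ?P" "\<Union>\<U> = U"
      unfolding union_of_def by (elim exE conjE)
    have "openin ?T B" if B: "B \<in> \<U>" for B
    proof -
      obtain K \<Phi> where "compactin Y K \<and> finite \<Phi> \<and> (\<forall>G\<in>\<Phi>. openin Y G)" "B = fell_basic Y K \<Phi>"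
        using subsetD[OF \<U>(1) B] by (elim CollectE exE conjE) simp
      then show ?thesis
        using * by simp
    qed
    then show ?thesis
      unfolding \<U>(2)[symmetric] by (rule openin_Union)
  qed
  moreover have "openin (fell_topology Y) U" if "openin ?T U" for U
    using minimal_topology_subbase[OF sub openin_topspace that] .
  ultimately show ?thesis
    unfolding topology_eq by blast
qed

text \<open>Compactness selects finitely many sets. Here finitely many indices are wanted, since
  each index will be a subset of \<open>Y\<close> whose own properties are used after the
  selection.\<close>

lemma compactin_indexed_cover:
  assumes "compactin X S" "\<And>i. i \<in> I \<Longrightarrow> openin X (f i)" "S \<subseteq> (\<Union>i\<in>I. f i)"
  obtains J where "finite J" "J \<subseteq> I" "S \<subseteq> (\<Union>i\<in>J. f i)"
proof -
  obtain \<F> where "finite \<F>" "\<F> \<subseteq> f ` I" "S \<subseteq> \<Union>\<F>"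
    using compactinD[OF assms(1), of "f ` I"] assms(2,3) by blast
  moreover from this obtain J where "finite J" "J \<subseteq> I" "\<F> = f ` J"
    using finite_subset_image[of \<F> f I] by blast
  ultimately show thesis
    using that by blast
qed

text \<open>Every cover by subbasic sets contains a set missing some compact \<open>K\<close> such
  that the open sets of its hitting sets cover \<open>K\<close>. Finitely many of these open sets
  cover \<open>K\<close>, and a closed set either misses \<open>K\<close> or meets one of
  them.\<close>

lemma compact_space_fell_topology: "compact_space (fell_topology Y)"
proof (rule Alexander_subbase_alt[OF _ _ fell_topology_subbase])
  let ?\<B> = "{fell_basic Y K {} |K. compactin Y K} \<union> {fell_basic Y {} {G} |G. openin Y G}"
  have "topspace (fell_topology Y) = fell_basic Y {} {}"
    by (auto simp: topspace_fell_topology fell_basic_def)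
  then show "topspace (fell_topology Y) \<subseteq> \<Union>?\<B>"
    using compactin_empty by blast
  fix C assume C: "C \<subseteq> ?\<B>" and cov: "topspace (fell_topology Y) \<subseteq> \<Union>C"
  define \<G> where "\<G> = {G. openin Y G \<and> fell_basic Y {} {G} \<in> C}"
  \<comment> \<open>This closed set meets no open set whose hitting set belongs to the cover, so the
    member of the cover containing it must be a set missing some compact \<open>K\<close>.\<close>
  have "closedin Y (topspace Y - \<Union>\<G>)"
    by (auto simp: \<G>_def)
  then obtain c where c: "c \<in> C" "topspace Y - \<Union>\<G> \<in> c"
    using cov by (auto simp: topspace_fell_topology)
  obtain K where K: "compactin Y K" "c = fell_basic Y K {}"
    using C c by (auto simp: \<G>_def fell_basic_def)
  have "K \<subseteq> \<Union>\<G>"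
    using c K compactin_subset_topspace[OF K(1)] by (auto simp: fell_basic_def)
  then obtain \<F> where \<F>: "finite \<F>" "\<F> \<subseteq> \<G>" "K \<subseteq> \<Union>\<F>"
    using compactinD[OF K(1), of \<G>] by (auto simp: \<G>_def)
  show "\<exists>C'. finite C' \<and> C' \<subseteq> C \<and> topspace (fell_topology Y) \<subseteq> \<Union>C'"
  proof (intro exI conjI)
    let ?C' = "insert c ((\<lambda>G. fell_basic Y {} {G}) ` \<F>)"
    show "finite ?C'" "?C' \<subseteq> C"
      using \<F> c by (auto simp: \<G>_def)
    show "topspace (fell_topology Y) \<subseteq> \<Union>?C'"
      using \<F>(3) K(2) by (fastforce simp: topspace_fell_topology fell_basic_def)
  qed
qed

section \<open>Hausdorff separation in the Fell topology\<close>

lemma locally_compact_Hausdorff_neighbourhood: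
  assumes "locally_compact_space Y" "Hausdorff_space Y" "closedin Y F" "y \<in> topspace Y" "y \<notin> F"
  obtains U K where "openin Y U" "compactin Y K" "y \<in> U" "U \<subseteq> K" "K \<inter> F = {}"
proof -
  have "neighbourhood_base_of (compactin Y) Y"
    using assms locally_compact_space_neighbourhood_base by blast
  moreover have "openin Y (topspace Y - F)"
    using assms by blast
  ultimately show thesis
    using assms that unfolding neighbourhood_base_of
    by (smt (verit, ccfv_threshold) Diff_iff disjoint_iff subset_eq)
qed

text \<open>A point \<open>y\<close> of one closed set outside the other has an open neighbourhood
  \<open>U\<close> inside a compact \<open>K\<close> that misses the other set. Hitting
  \<open>U\<close> and missing \<open>K\<close> are disjoint Fell-open conditions because
  \<open>U\<close> lies in \<open>K\<close>.\<close>

lemma Hausdorff_space_fell_topology: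
  assumes "locally_compact_space Y" "Hausdorff_space Y"
  shows "Hausdorff_space (fell_topology Y)"
proof -
  have sep: "\<exists>U V. openin (fell_topology Y) U \<and> openin (fell_topology Y) V \<and>
               F \<in> U \<and> G \<in> V \<and> disjnt U V"
    if FG: "closedin Y F" "closedin Y G" "y \<in> F" "y \<notin> G" for F G y
  proof -
    obtain U K where UK: "openin Y U" "compactin Y K" "y \<in> U" "U \<subseteq> K" "K \<inter> G = {}"
      using locally_compact_Hausdorff_neighbourhood[OF assms FG(2) _ FG(4)]
        closedin_subset[OF FG(1)] FG(3) by blast
    show ?thesis
    proof (intro exI conjI)
      show "openin (fell_topology Y) (fell_basic Y {} {U})" "openin (fell_topology Y) (fell_basic Y K {})"
        using UK by (auto intro: openin_fell_basic)
    qed (use FG UK in \<open>auto simp: fell_basic_def disjnt_iff\<close>)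
  qed
  show ?thesis
    unfolding Hausdorff_space_def topspace_fell_topology
  proof (intro allI impI, elim conjE)
    fix F G assume FG: "F \<in> {S. closedin Y S}" "G \<in> {S. closedin Y S}" "F \<noteq> G"
    then consider y where "y \<in> F" "y \<notin> G" | y where "y \<in> G" "y \<notin> F"
      by blast
    then show "\<exists>U V. openin (fell_topology Y) U \<and> openin (fell_topology Y) V \<and>
               F \<in> U \<and> G \<in> V \<and> disjnt U V"
      using sep FG by cases (blast, metis disjnt_sym mem_Collect_eq)
  qed
qed

section \<open>Closed and compact families of closed sets\<close>

lemma closedin_fell_topology_hitting:
  assumes "compactin Y K"
  shows "closedin (fell_topology Y) {S. closedin Y S \<and> S \<inter> K \<noteq> {}}"
proof -
  have "{S. closedin Y S \<and> S \<inter> K \<noteq> {}} = topspace (fell_topology Y) - fell_basic Y K {}"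
    by (auto simp: topspace_fell_topology fell_basic_def)
  then show ?thesis
    using closedin_diff[OF closedin_topspace openin_fell_basic[OF assms, of "{}"]] by simp
qed

text \<open>If \<open>y\<close> lies outside the union, each member misses some compact
  neighbourhood of \<open>y\<close>. Since the family is Fell-compact, finitely many such
  neighbourhoods serve all members, and their intersection is a neighbourhood of \<open>y\<close>
  off the union.\<close>

lemma closedin_Union_fell:
  assumes Y: "locally_compact_space Y" "Hausdorff_space Y"
    and \<A>: "closedin (fell_topology Y) \<A>"
  shows "closedin Y (\<Union>\<A>)"
  unfolding closedin_def
proof
  have cl: "closedin Y F" if "F \<in> \<A>" for F
    using that closedin_subset[OF \<A>] by (auto simp: topspace_fell_topology)
  then show "\<Union>\<A> \<subseteq> topspace Y"
    using closedin_subset by blast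
  have comp: "compactin (fell_topology Y) \<A>"
    using \<A> compact_space_fell_topology closedin_compact_space by blast
  show "openin Y (topspace Y - \<Union>\<A>)"
  proof (subst openin_subopen, intro ballI)
    fix y assume y: "y \<in> topspace Y - \<Union>\<A>"
    define \<K> where "\<K> = {K. compactin Y K \<and> (\<exists>U. openin Y U \<and> y \<in> U \<and> U \<subseteq> K)}"
    have "\<exists>K\<in>\<K>. F \<in> fell_basic Y K {}" if F: "F \<in> \<A>" for F
    proof -
      obtain U K where "openin Y U" "compactin Y K" "y \<in> U" "U \<subseteq> K" "K \<inter> F = {}"
        using locally_compact_Hausdorff_neighbourhood[OF Y cl[OF F], of y] F y by blast
      then show ?thesis
        using cl[OF F] by (intro bexI[of _ K]) (auto simp: \<K>_def fell_basic_def)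
    qed
    then have cov: "\<A> \<subseteq> (\<Union>K\<in>\<K>. fell_basic Y K {})"
      by blast
    obtain \<L> where \<L>: "finite \<L>" "\<L> \<subseteq> \<K>" "\<A> \<subseteq> (\<Union>K\<in>\<L>. fell_basic Y K {})"
      by (rule compactin_indexed_cover[OF comp _ cov]) (auto simp: \<K>_def intro: openin_fell_basic)
    have "\<forall>K\<in>\<L>. \<exists>U. openin Y U \<and> y \<in> U \<and> U \<subseteq> K"
      using \<L>(2) by (auto simp: \<K>_def)
    from bchoice[OF this] obtain U where U: "\<forall>K\<in>\<L>. openin Y (U K) \<and> y \<in> U K \<and> U K \<subseteq> K"
      by blast
    show "\<exists>T. openin Y T \<and> y \<in> T \<and> T \<subseteq> topspace Y - \<Union>\<A>"
    proof (intro exI conjI)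
      \<comment> \<open>If \<open>\<L>\<close> is empty, the intersection over it is the universal
        set, so it is cut down to the space.\<close>
      let ?T = "(\<Inter>K\<in>\<L>. U K) \<inter> topspace Y"
      show "openin Y ?T"
        using \<L>(1) U by (intro openin_INT) auto
      show "y \<in> ?T"
        using y U by blast
      show "?T \<subseteq> topspace Y - \<Union>\<A>"
      proof
        fix z assume z: "z \<in> ?T"
        have False if F: "F \<in> \<A>" "z \<in> F" for F
        proof -
          obtain K where "K \<in> \<L>" "F \<inter> K = {}"
            using \<L>(3) F(1) by (auto simp: fell_basic_def)
          then show False
            using U z F(2) by blast
        qed
        then show "z \<in> topspace Y - \<Union>\<A>"
          using z by blast
      qed
    qed
  qed
qed

text \<open>By local compactness each nonempty member meets an open set with a compact superset.
  Finitely many such open sets suffice for the whole family, and \<open>K\<close> is the union of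
  their compact supersets.\<close>

lemma compactin_fell_topology_hitting_set:
  assumes Y: "locally_compact_space Y"
    and \<A>: "compactin (fell_topology Y) \<A>" "{} \<notin> \<A>"
  obtains K where "compactin Y K" "\<And>S. S \<in> \<A> \<Longrightarrow> S \<inter> K \<noteq> {}"
proof -
  define \<G> where "\<G> = {G. openin Y G \<and> (\<exists>K. compactin Y K \<and> G \<subseteq> K)}"
  have "\<exists>G\<in>\<G>. S \<in> fell_basic Y {} {G}" if S: "S \<in> \<A>" for S
  proof -
    have cl: "closedin Y S"
      using S compactin_subset_topspace[OF \<A>(1)] by (auto simp: topspace_fell_topology)
    obtain y where y: "y \<in> S"
      using S \<A>(2) by fastforce
    obtain U K where U: "openin Y U" "compactin Y K" "y \<in> U" "U \<subseteq> K"
      using Y[unfolded locally_compact_space_def, rule_format, of y] y closedin_subset[OF cl] by auto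
    then have "U \<in> \<G>"
      unfolding \<G>_def by blast
    moreover have "S \<in> fell_basic Y {} {U}"
      using y cl U(3) unfolding fell_basic_def by blast
    ultimately show ?thesis
      by (rule bexI[rotated])
  qed
  then have cov: "\<A> \<subseteq> (\<Union>G\<in>\<G>. fell_basic Y {} {G})"
    by blast
  obtain \<H> where \<H>: "finite \<H>" "\<H> \<subseteq> \<G>" "\<A> \<subseteq> (\<Union>G\<in>\<H>. fell_basic Y {} {G})"
    by (rule compactin_indexed_cover[OF \<A>(1) _ cov]) (auto simp: \<G>_def intro: openin_fell_basic)
  have "\<forall>G\<in>\<H>. \<exists>K. compactin Y K \<and> G \<subseteq> K"
    using \<H>(2) by (auto simp: \<G>_def)
  from bchoice[OF this] obtain K where K: "\<forall>G\<in>\<H>. compactin Y (K G) \<and> G \<subseteq> K G"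
    by blast
  show thesis
  proof
    show "compactin Y (\<Union>(K ` \<H>))"
      using \<H>(1) K by (intro compactin_Union) auto
    show "S \<inter> \<Union>(K ` \<H>) \<noteq> {}" if "S \<in> \<A>" for S
    proof -
      from subsetD[OF \<H>(3) \<open>S \<in> \<A>\<close>] obtain G where "G \<in> \<H>" "S \<inter> G \<noteq> {}"
         by (auto simp: fell_basic_def)
      then show ?thesis
        using K by blast
    qed
  qed
qed

section \<open>The space of limits of fibres\<close>

lemma closedin_fibre:
  assumes "continuous_map Y X q" "Hausdorff_space X" "F \<in> fibres Y X q"
  shows "closedin Y F"
proof -
  obtain x where x: "x \<in> topspace X" "F = {y \<in> topspace Y. q y \<in> {x}}"
    using assms(3) by (auto simp: fibres_def)
  have "closedin X {x}"
    using x(1) closedin_Hausdorff_sing_eq[OF assms(2)] by simp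
  then show ?thesis
    unfolding x(2) by (rule closedin_continuous_map_preimage[OF assms(1)])
qed

lemma fibre_nonempty:
  assumes "quotient_map Y X q" "F \<in> fibres Y X q"
  shows "F \<noteq> {}"
proof -
  obtain x where x: "x \<in> topspace X" "F = {y \<in> topspace Y. q y = x}"
    using assms(2) by (auto simp: fibres_def)
  then have "x \<in> q ` topspace Y"
    by (simp only: quotient_imp_surjective_map[OF assms(1)])
  then show ?thesis
    unfolding x(2) by auto
qed

locale Hausdorff_quotient =
  fixes Y :: "'a topology" and X :: "'b topology" and q :: "'a \<Rightarrow> 'b"
  assumes locally_compact: "locally_compact_space Y"
    and sigma_compact: "sigma_compact_space Y"
    and Hausdorff_dom: "Hausdorff_space Y"
    and Hausdorff_cod: "Hausdorff_space X"
    and quotient: "quotient_map Y X q"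
begin

lemma fibres_subset_fell: "fibres Y X q \<subseteq> topspace (fell_topology Y) - {{}}"
proof
  fix F assume F: "F \<in> fibres Y X q"
  have "closedin Y F"
    using quotient_imp_continuous_map[OF quotient] Hausdorff_cod F by (rule closedin_fibre)
  then show "F \<in> topspace (fell_topology Y) - {{}}"
    using fibre_nonempty[OF quotient F] by (simp add: topspace_fell_topology)
qed

text \<open>Trades the closure among nonempty closed sets for the closure in the full hyperspace,
  which is compact, with a single point removed.\<close>

lemma star_space_eq: "star_space Y X q = fell_topology Y closure_of fibres Y X q - {{}}"
proof -
  let ?C = "fell_topology Y closure_of fibres Y X q"
  have "star_space Y X q = (topspace (fell_topology Y) - {{}}) \<inter> ?C"
    unfolding star_space_def by (rule closure_of_subtopology_open[OF disjI2[OF fibres_subset_fell]])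
  also have "\<dots> = topspace (fell_topology Y) \<inter> ?C - {{}}"
    by (simp only: Int_commute[of _ ?C] Int_Diff)
  also have "topspace (fell_topology Y) \<inter> ?C = ?C"
    using closure_of_subset_topspace by (rule Int_absorb1)
  finally show ?thesis .
qed

lemma in_star_space_iff:
  "F \<in> star_space Y X q \<longleftrightarrow> F \<in> fell_topology Y closure_of fibres Y X q \<and> F \<noteq> {}"
  by (simp add: star_space_eq)

lemma fibres_subset_star_space: "fibres Y X q \<subseteq> star_space Y X q"
proof
  fix F assume F: "F \<in> fibres Y X q"
  have "fibres Y X q \<subseteq> topspace (fell_topology Y)"
    using fibres_subset_fell by (rule subset_trans) (rule Diff_subset)
  then have "F \<in> fell_topology Y closure_of fibres Y X q"
    using subsetD[OF closure_of_subset F] by simp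
  then show "F \<in> star_space Y X q"
    using fibre_nonempty[OF quotient F] by (simp add: in_star_space_iff)
qed

lemma closedin_star:
  assumes "F \<in> star_space Y X q"
  shows "closedin Y F"
proof -
  have "F \<in> fell_topology Y closure_of fibres Y X q"
    using assms by (simp add: in_star_space_iff)
  then have "F \<in> topspace (fell_topology Y)"
    by (rule subsetD[OF closure_of_subset_topspace])
  then show ?thesis
    by (simp add: topspace_fell_topology)
qed

lemma topspace_star_topology: "topspace (star_topology Y X q) = star_space Y X q"
  unfolding star_topology_def topspace_subtopology topspace_fell_topology
  by (rule Int_absorb1) (simp add: subset_iff closedin_star)

lemma star_map_point:
  "\<lbrakk>F \<in> star_space Y X q; y \<in> F\<rbrakk> \<Longrightarrow> star_map q F = q y"
  by (rule star_map_eq[OF quotient Hausdorff_cod])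

lemma star_member: "\<lbrakk>F \<in> star_space Y X q; y \<in> F\<rbrakk> \<Longrightarrow> y \<in> topspace Y"
  using closedin_subset[OF closedin_star] by (rule subsetD)

lemma star_nonempty: "F \<in> star_space Y X q \<Longrightarrow> \<exists>y. y \<in> F"
  by (simp add: in_star_space_iff ex_in_conv)

lemma point_fibre:
  assumes "y \<in> topspace Y"
  shows "{z \<in> topspace Y. q z = q y} \<in> fibres Y X q"
  unfolding fibres_def quotient_imp_surjective_map[OF quotient, symmetric] using assms by blast

section \<open>Local compactness, separation and sigma-compactness of the star space\<close>

lemma locally_compact_star_topology: "locally_compact_space (star_topology Y X q)"
proof -
  let ?C = "fell_topology Y closure_of fibres Y X q"
  have H: "Hausdorff_space (subtopology (fell_topology Y) ?C)"
    using Hausdorff_space_fell_topology[OF locally_compact Hausdorff_dom]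
    by (rule Hausdorff_space_subtopology)
  have "locally_compact_space (subtopology (fell_topology Y) ?C)"
    by (simp add: locally_compact_space_closed_subset compact_imp_locally_compact_space
        compact_space_fell_topology)
  \<comment> \<open>The closed sets that hit all of \<open>Y\<close> are exactly the nonempty ones,
    so deleting the empty set leaves an open subset of the compact Hausdorff closure.\<close>
  moreover have "openin (fell_topology Y) (fell_basic Y {} {topspace Y})"
    by (rule openin_fell_basic) auto
  then have "openin (subtopology (fell_topology Y) ?C) (?C \<inter> fell_basic Y {} {topspace Y})"
    by (auto simp: openin_subtopology)
  moreover have "?C \<inter> fell_basic Y {} {topspace Y} = star_space Y X q"
  proof
    show "?C \<inter> fell_basic Y {} {topspace Y} \<subseteq> star_space Y X q"
      by (auto simp: star_space_eq fell_basic_def)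
    show "star_space Y X q \<subseteq> ?C \<inter> fell_basic Y {} {topspace Y}"
    proof
      fix F assume F: "F \<in> star_space Y X q"
      then have "F \<inter> topspace Y \<noteq> {}"
        using star_nonempty star_member by blast
      then show "F \<in> ?C \<inter> fell_basic Y {} {topspace Y}"
        using F closedin_star[OF F] by (simp add: in_star_space_iff fell_basic_def)
    qed
  qed
  ultimately have "locally_compact_space (subtopology (subtopology (fell_topology Y) ?C) (star_space Y X q))"
    using locally_compact_space_open_subset[OF disjI1[OF H]] by simp
  moreover have "?C \<inter> star_space Y X q = star_space Y X q"
    by (auto simp: star_space_eq)
  ultimately show ?thesis
    by (simp add: star_topology_def subtopology_subtopology)
qed

lemma Hausdorff_star_topology: "Hausdorff_space (star_topology Y X q)"
  unfolding star_topology_def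
  using Hausdorff_space_fell_topology[OF locally_compact Hausdorff_dom]
  by (rule Hausdorff_space_subtopology)

text \<open>Meeting \<open>K\<close> is a Fell-closed condition that already excludes the empty set.
  The family is therefore closed in the full compact hyperspace, not merely in the star
  space.\<close>

lemma compactin_star_topology_hitting:
  assumes "compactin Y K"
  shows "compactin (star_topology Y X q) {F \<in> star_space Y X q. F \<inter> K \<noteq> {}}"
proof -
  have "{F \<in> star_space Y X q. F \<inter> K \<noteq> {}} =
        fell_topology Y closure_of fibres Y X q \<inter> {S. closedin Y S \<and> S \<inter> K \<noteq> {}}"
  proof
    show "{F \<in> star_space Y X q. F \<inter> K \<noteq> {}} \<subseteq>
        fell_topology Y closure_of fibres Y X q \<inter> {S. closedin Y S \<and> S \<inter> K \<noteq> {}}"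
      using closedin_star by (simp add: subset_iff in_star_space_iff)
  qed (auto simp: star_space_eq)
  then have "closedin (fell_topology Y) {F \<in> star_space Y X q. F \<inter> K \<noteq> {}}"
    using closedin_Int[OF closedin_closure_of closedin_fell_topology_hitting[OF assms]] by simp
  then have "compactin (fell_topology Y) {F \<in> star_space Y X q. F \<inter> K \<noteq> {}}"
    by (rule closedin_compact_space[OF compact_space_fell_topology])
  then show ?thesis
    by (simp add: star_topology_def compactin_subtopology)
qed

lemma sigma_compact_star_topology: "sigma_compact_space (star_topology Y X q)"
proof -
  obtain \<K> where \<K>: "countable \<K>" "\<forall>K\<in>\<K>. compactin Y K" "\<Union>\<K> = topspace Y"
    using sigma_compact unfolding sigma_compact_space_def by (elim exE conjE)
  show ?thesis
    unfolding sigma_compact_space_def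
  proof (intro exI conjI)
    let ?\<L> = "(\<lambda>K. {F \<in> star_space Y X q. F \<inter> K \<noteq> {}}) ` \<K>"
    show "countable ?\<L>" "\<forall>K\<in>?\<L>. compactin (star_topology Y X q) K"
      using \<K> compactin_star_topology_hitting by auto
    show "\<Union>?\<L> = topspace (star_topology Y X q)"
    proof
      show "topspace (star_topology Y X q) \<subseteq> \<Union>?\<L>"
      proof
        fix F assume "F \<in> topspace (star_topology Y X q)"
        then have F: "F \<in> star_space Y X q"
          by (simp add: topspace_star_topology)
        then obtain y where "y \<in> F"
          using star_nonempty by blast
        moreover from this have "y \<in> \<Union>\<K>"
          using star_member[OF F] \<K>(3) by simp
        then obtain K where "K \<in> \<K>" "y \<in> K"
          by (rule UnionE)
        ultimately show "F \<in> \<Union>?\<L>"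
          using F by blast
      qed
    qed (auto simp: topspace_star_topology)
  qed
qed

section \<open>The quotient map on the star space\<close>

text \<open>Since \<open>q\<close> is constant on each member, a member is sent into
  \<open>U\<close> exactly when it meets the preimage of \<open>U\<close> under \<open>q\<close>.
  Preimages of open sets are thus traces of hitting sets.\<close>

lemma continuous_star_map: "continuous_map (star_topology Y X q) X (star_map q)"
  unfolding continuous_map_def
proof (intro conjI allI impI)
  show "star_map q \<in> topspace (star_topology Y X q) \<rightarrow> topspace X"
  proof
    fix F assume "F \<in> topspace (star_topology Y X q)"
    then have F: "F \<in> star_space Y X q"
      by (simp add: topspace_star_topology)
    then obtain y where y: "y \<in> F"
      using star_nonempty by blast
    show "star_map q F \<in> topspace X"
      using star_map_point[OF F y] star_member[OF F y] quotient_imp_surjective_map[OF quotient] by auto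
  qed
  fix U assume U: "openin X U"
  let ?V = "{y \<in> topspace Y. q y \<in> U}"
  have V: "openin Y ?V"
    using U quotient_imp_continuous_map[OF quotient] by (simp add: openin_continuous_map_preimage)
  have "{F \<in> topspace (star_topology Y X q). star_map q F \<in> U} = fell_basic Y {} {?V} \<inter> star_space Y X q"
  proof -
    have "star_map q F \<in> U \<longleftrightarrow> F \<in> fell_basic Y {} {?V}" if F: "F \<in> star_space Y X q" for F
    proof -
      obtain y where y: "y \<in> F"
        using F star_nonempty by blast
      have "F \<inter> ?V \<noteq> {} \<longleftrightarrow> star_map q F \<in> U"
        using y star_map_point[OF F] star_member[OF F] by fastforce
      then show ?thesis
        using closedin_star[OF F] by (simp add: fell_basic_def)
    qed
    then show ?thesis
      unfolding topspace_star_topology by blast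
  qed
  moreover have "openin (fell_topology Y) (fell_basic Y {} {?V})"
    using V by (auto intro: openin_fell_basic)
  ultimately show "openin (star_topology Y X q) {F \<in> topspace (star_topology Y X q). star_map q F \<in> U}"
    by (auto simp: star_topology_def openin_subtopology)
qed

lemma closedin_Union_star:
  assumes "closedin (star_topology Y X q) \<A>"
  shows "closedin Y (\<Union>\<A>)"
proof -
  obtain T where T: "closedin (fell_topology Y) T" "\<A> = T \<inter> star_space Y X q"
    using assms by (auto simp: star_topology_def closedin_subtopology)
  \<comment> \<open>A family closed in the star space need not be Fell-closed. This Fell-closed
    family exceeds it by at most the empty set, which adds nothing to the union.\<close>
  let ?B = "T \<inter> fell_topology Y closure_of fibres Y X q"
  have "closedin Y (\<Union>?B)"
    using T by (intro closedin_Union_fell locally_compact Hausdorff_dom) auto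
  moreover have "\<Union>?B = \<Union>\<A>"
    by (auto simp: T(2) star_space_eq)
  ultimately show ?thesis by simp
qed

text \<open>One inclusion uses that \<open>q\<close> is constant on members. The other uses that the
  whole fibre through a point is itself a member. This translates preimages under
  \<open>star_map q\<close> into preimages under \<open>q\<close>.\<close>

lemma Union_star_preimage:
  "\<Union>{F \<in> topspace (star_topology Y X q). star_map q F \<in> C} = {y \<in> topspace Y. q y \<in> C}"
proof (intro equalityI subsetI)
  fix y assume "y \<in> \<Union>{F \<in> topspace (star_topology Y X q). star_map q F \<in> C}"
  then show "y \<in> {y \<in> topspace Y. q y \<in> C}"
    unfolding topspace_star_topology using star_map_point star_member by force
next
  fix y assume y: "y \<in> {y \<in> topspace Y. q y \<in> C}"
  let ?F = "{z \<in> topspace Y. q z = q y}"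
  have "?F \<in> star_space Y X q"
    using y point_fibre fibres_subset_star_space by blast
  moreover from this have "star_map q ?F = q y"
    using y by (intro star_map_point) auto
  ultimately show "y \<in> \<Union>{F \<in> topspace (star_topology Y X q). star_map q F \<in> C}"
    using y by (intro UnionI[of ?F]) (auto simp: topspace_star_topology)
qed

lemma quotient_star_map: "quotient_map (star_topology Y X q) X (star_map q)"
  unfolding quotient_map_closedin
proof (intro conjI allI impI)
  show "star_map q ` topspace (star_topology Y X q) = topspace X"
  proof
    show "star_map q ` topspace (star_topology Y X q) \<subseteq> topspace X"
      using continuous_star_map continuous_map_image_subset_topspace by blast
    have "q y \<in> star_map q ` topspace (star_topology Y X q)" if "y \<in> topspace Y" for y
    proof -
      \<comment> \<open>Taking a singleton for \<open>C\<close> yields a member over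
        \<open>q y\<close>, so surjectivity is inherited from \<open>q\<close>.\<close>
      have "y \<in> \<Union>{F \<in> topspace (star_topology Y X q). star_map q F \<in> {q y}}"
        unfolding Union_star_preimage using that by simp
      then show ?thesis
        by (elim UnionE CollectE conjE) (simp add: image_iff, metis)
    qed
    then show "topspace X \<subseteq> star_map q ` topspace (star_topology Y X q)"
      unfolding quotient_imp_surjective_map[OF quotient, symmetric] by (rule image_subsetI)
  qed
  fix C assume C: "C \<subseteq> topspace X"
  show "closedin (star_topology Y X q) {F \<in> topspace (star_topology Y X q). star_map q F \<in> C}
        \<longleftrightarrow> closedin X C"
  proof
    assume "closedin (star_topology Y X q) {F \<in> topspace (star_topology Y X q). star_map q F \<in> C}"
    \<comment> \<open>The union of the closed family is closed in \<open>Y\<close> and equals the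
      preimage of \<open>C\<close> under \<open>q\<close>, to which the quotient property of
      \<open>q\<close> applies.\<close>
    then have "closedin Y {y \<in> topspace Y. q y \<in> C}"
      using closedin_Union_star unfolding Union_star_preimage[symmetric] by simp
    then show "closedin X C"
      using quotient C by (simp add: quotient_map_closedin)
  next
    assume "closedin X C"
    then show "closedin (star_topology Y X q) {F \<in> topspace (star_topology Y X q). star_map q F \<in> C}"
      using continuous_star_map closedin_continuous_map_preimage by blast
  qed
qed

section \<open>Purity\<close>

lemma star_subset_fibre:
  assumes "E \<in> star_space Y X q" "F \<in> fibres Y X q" "star_map q E = star_map q F"
  shows "E \<subseteq> F"
proof
  fix y assume y: "y \<in> E"
  obtain x where F: "F = {z \<in> topspace Y. q z = x}"
    using assms(2) by (auto simp: fibres_def)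
  have FS: "F \<in> star_space Y X q"
    using assms(2) fibres_subset_star_space by blast
  then obtain z where "z \<in> F"
    using star_nonempty by blast
  then have "star_map q F = x"
    using star_map_point[OF FS] F by simp
  moreover have "star_map q E = q y" "y \<in> topspace Y"
    using star_map_point[OF assms(1) y] star_member[OF assms(1) y] by auto
  ultimately show "y \<in> F"
    using assms(3) F by auto
qed

lemma pure_witness_fibres: "pure_witness (star_topology Y X q) (star_map q) (fibres Y X q)"
  unfolding pure_witness_def
proof (intro conjI allI impI)
  show "fibres Y X q \<subseteq> topspace (star_topology Y X q)"
    using fibres_subset_star_space by (simp add: topspace_star_topology)
  show "star_topology Y X q closure_of fibres Y X q = topspace (star_topology Y X q)"
  proof -
    have "star_topology Y X q closure_of fibres Y X q =
          star_space Y X q \<inter> fell_topology Y closure_of fibres Y X q"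
      unfolding star_topology_def
      by (rule closure_of_subtopology_open) (simp add: fibres_subset_star_space)
    then show ?thesis
      unfolding topspace_star_topology by (auto simp: star_space_eq)
  qed
  show "inj_on (star_map q) (fibres Y X q)"
  proof (rule inj_onI)
    fix E F assume EF: "E \<in> fibres Y X q" "F \<in> fibres Y X q" "star_map q E = star_map q F"
    then have "E \<in> star_space Y X q" "F \<in> star_space Y X q"
      using fibres_subset_star_space by blast+
    \<comment> \<open>Both sets are fibres, so the inclusion in a fibre with the same image holds in
      each direction.\<close>
    then show "E = F"
      using EF by (intro subset_antisym star_subset_fibre) simp_all
  qed
next
  fix I :: "'a set set set" and r d e
  assume *: "directed_set I r \<and> d \<in> I \<rightarrow> fibres Y X q \<and>
     net_to_infinity (star_topology Y X q) I r d \<and>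
     e \<in> I \<rightarrow> topspace (star_topology Y X q) \<and> (\<forall>i\<in>I. star_map q (e i) = star_map q (d i))"
  have r: "r \<subseteq> I \<times> I"
    using * by (simp add: directed_set_def preorder_on_def)
  have sub: "e i \<subseteq> d i" "d i \<in> star_space Y X q" if "i \<in> I" for i
  proof -
    have i: "d i \<in> fibres Y X q" "e i \<in> star_space Y X q" "star_map q (e i) = star_map q (d i)"
      using * that unfolding topspace_star_topology by blast+
    show "e i \<subseteq> d i"
      using i(2,1,3) by (rule star_subset_fibre)
    show "d i \<in> star_space Y X q"
      using i(1) fibres_subset_star_space by blast
  qed
  show "net_to_infinity (star_topology Y X q) I r e"
    unfolding net_to_infinity_def
  proof (intro allI impI)
    fix \<A> assume "compactin (star_topology Y X q) \<A>"
    then have "compactin (fell_topology Y) \<A>" "{} \<notin> \<A>"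
      by (auto simp: star_topology_def compactin_subtopology star_space_eq)
    then obtain K where K: "compactin Y K" "\<And>S. S \<in> \<A> \<Longrightarrow> S \<inter> K \<noteq> {}"
      using compactin_fell_topology_hitting_set[OF locally_compact] by blast
    \<comment> \<open>The given compact family is enlarged to all members meeting \<open>K\<close>.
      Unlike \<open>\<A>\<close>, this family contains every member that is a superset of one of its
      elements, so avoiding it passes from \<open>d j\<close> to its subset
      \<open>e j\<close>.\<close>
    obtain i where i: "i \<in> I" "\<And>j. (i, j) \<in> r \<Longrightarrow> d j \<notin> {F \<in> star_space Y X q. F \<inter> K \<noteq> {}}"
      using * compactin_star_topology_hitting[OF K(1)] unfolding net_to_infinity_def by blast
    have "e j \<notin> \<A>" if j: "(i, j) \<in> r" for j
      using i(2)[OF j] sub[of j] r j K(2)[of "e j"] by blast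
    then show "\<exists>i\<in>I. \<forall>j. (i, j) \<in> r \<longrightarrow> e j \<notin> \<A>"
      using i(1) by blast
  qed
qed

end

theorem theorem3p6:
  fixes Y :: "'a topology" and X :: "'b topology" and q :: "'a \<Rightarrow> 'b"
  assumes "locally_compact_space Y" and "sigma_compact_space Y" and "Hausdorff_space Y"
    and "Hausdorff_space X" and "quotient_map Y X q"
  shows "locally_compact_space (star_topology Y X q) \<and>
         sigma_compact_space (star_topology Y X q) \<and>
         Hausdorff_space (star_topology Y X q) \<and>
         pure_quotient_map (star_topology Y X q) X (star_map q) \<and>
         (\<forall>C \<subseteq> topspace X.
            closedin (star_topology Y X q) {F \<in> topspace (star_topology Y X q). star_map q F \<in> C} \<longleftrightarrow>
            closedin Y {y \<in> topspace Y. q y \<in> C})"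
proof -
  interpret Hausdorff_quotient Y X q
    using assms by unfold_locales
  show ?thesis
    \<comment> \<open>The two preimages of \<open>C\<close> are closed under the same condition,
      namely that \<open>C\<close> is closed in \<open>X\<close>, because both maps are quotient
      maps.\<close>
    using locally_compact_star_topology sigma_compact_star_topology Hausdorff_star_topology
      Hausdorff_cod quotient_star_map pure_witness_fibres quotient
    by (auto simp: pure_quotient_map_def quotient_map_closedin)
qed

end
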